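(* Let $p$ be a prime number and let $A$ be a subset of the cyclic group $\mathbb{Z}/p\mathbb{Z}$ of size $k$, where $k\cdot 2^{k-1}<p$. Suppose $A\cap 2A=\emptyset$, where $2A=\{2a : a\in A\}$. Then the identity map $\mathrm{id}:A\to A$ is an acyclic matching from $A$ to $A$.
   Context: Let $G$ be an additive abelian group and let $A,B$ be finite subsets of $G$ of the same cardinality with $0\notin B$. A matching from $A$ to $B$ is a bijection $f:A\to B$ such that $a+f(a)\notin A$ for every $a\in A$. The multiplicity function of a matching $f$ is $m_f:G\to\mathbb{Z}_{\ge 0}$, $m_f(x)=\#\{a\in A : a+f(a)=x\}$. A matching $f:A\to B$ is called acyclic if for every matching $g:A\to B$, $m_f=m_g$ implies $f=g$. *)

theory Defs
  imports "HOL-Algebra.Elementary_Groups" "HOL-Computational_Algebra.Primes"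
begin

text \<open>
  Additive abelian groups are rendered as commutative groups of HOL-Algebra,
  whose notation is multiplicative: \<open>a \<otimes>\<^bsub>G\<^esub> b\<close> is the sum \<open>a + b\<close>, \<open>\<one>\<^bsub>G\<^esub>\<close> is \<open>0\<close>, and
  \<open>a [^]\<^bsub>G\<^esub> n\<close> is the multiple \<open>n a\<close>.  In particular, \<open>integer_mod_group p\<close> is the additive group
  of integers modulo \<open>p\<close>, with carrier \<open>{0..<int p}\<close> for positive \<open>p\<close>.
\<close>

definition matchable_pair :: "('a, 'b) monoid_scheme \<Rightarrow> 'a set \<Rightarrow> 'a set \<Rightarrow> bool" where
  "matchable_pair G A B \<longleftrightarrow>
     comm_group G \<and> A \<subseteq> carrier G \<and> B \<subseteq> carrier G \<and> finite A \<and> finite B \<and>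
     card A = card B \<and> \<one>\<^bsub>G\<^esub> \<notin> B"

definition matching ::
  "('a, 'b) monoid_scheme \<Rightarrow> 'a set \<Rightarrow> 'a set \<Rightarrow> ('a \<Rightarrow> 'a) \<Rightarrow> bool" where
  "matching G A B f \<longleftrightarrow>
     matchable_pair G A B \<and> bij_betw f A B \<and> (\<forall>a\<in>A. a \<otimes>\<^bsub>G\<^esub> f a \<notin> A)"

definition matching_mult ::
  "('a, 'b) monoid_scheme \<Rightarrow> 'a set \<Rightarrow> ('a \<Rightarrow> 'a) \<Rightarrow> 'a \<Rightarrow> nat" where
  "matching_mult G A f x = card {a \<in> A. a \<otimes>\<^bsub>G\<^esub> f a = x}"

text \<open>
  A map from \<open>A\<close> to \<open>B\<close> is represented by a total function whose values outside \<open>A\<close> are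
  irrelevant, so equality of matchings is equality on \<open>A\<close>; likewise multiplicity functions
  are maps on the carrier of \<open>G\<close>.
\<close>

definition acyclic_matching ::
  "('a, 'b) monoid_scheme \<Rightarrow> 'a set \<Rightarrow> 'a set \<Rightarrow> ('a \<Rightarrow> 'a) \<Rightarrow> bool" where
  "acyclic_matching G A B f \<longleftrightarrow>
     matching G A B f \<and>
     (\<forall>g. matching G A B g \<longrightarrow>
          (\<forall>x\<in>carrier G. matching_mult G A f x = matching_mult G A g x) \<longrightarrow>
          (\<forall>a\<in>A. f a = g a))"

end

theory Submission
  imports Defs "HOL-Number_Theory.Cong" "HOL-Library.Multiset"
begin

text \<open>
  Suppose that a matching \<open>g\<close> has the same multiplicities as the identity.  For odd \<open>p\<close> this
  means \<open>a + g a = 2 h a\<close> with a second permutation \<open>h\<close> of \<open>A\<close>.  Indexed by \<open>b = h a\<close>, each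
  element \<open>b\<close> of \<open>A\<close> is the average of \<open>\<sigma> b = g (h\<^sup>-\<^sup>1 b)\<close> and \<open>\<tau> b = h\<^sup>-\<^sup>1 b\<close>: the inclusion of \<open>A\<close>
  in \<open>\<int>/p\<close> is a harmonic function on the directed graph with edges \<open>b \<rightarrow> \<sigma> b\<close> and \<open>b \<rightarrow> \<tau> b\<close>.
  Over the reals a harmonic function on this graph is constant along edges, because the
  permutations preserve its sum of squares; constancy would give \<open>h = id\<close> and then \<open>g = id\<close>.  The task is to transfer this to \<open>\<int>/p\<close>.

  The transfer uses chip firing.  Let \<open>x\<close> be harmonic modulo \<open>p\<close>, let \<open>r\<close> be a vertex, and let
  \<open>V\<close> be the set of vertices from which \<open>r\<close> can be reached.  Since \<open>\<sigma>\<close> and \<open>\<tau>\<close> are permutations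
  of a finite set, \<open>V\<close> is closed under both.  A multiset over \<open>V\<close> is a configuration of chips.
  Firing a vertex \<open>b \<noteq> r\<close>, that is, replacing two chips at \<open>b\<close> by one at \<open>\<sigma> b\<close> and one at
  \<open>\<tau> b\<close>, changes neither the number of chips nor, modulo \<open>p\<close>, the sum of \<open>x\<close> over them.
  Chips tend towards \<open>r\<close>, so firing ends (\<open>firing_stabilises\<close>) in a configuration with
  at most one chip at each vertex other than \<open>r\<close>.  When the number of chips is given, such a
  configuration is determined by a subset of \<open>V - {r}\<close>, so sums over \<open>p - 1\<close> chips take at most
  \<open>2 ^ (card V - 1)\<close> values modulo \<open>p\<close>.  But if \<open>x u\<close> and \<open>x r\<close> differ modulo \<open>p\<close> for some \<open>u\<close>
  in \<open>V\<close>, then \<open>j\<close> chips at \<open>u\<close> and \<open>p - 1 - j\<close> at \<open>r\<close> give \<open>p\<close> different values.  Hence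
  \<open>p \<le> 2 ^ (card V - 1)\<close> (\<open>harmonic_with_weight_bound\<close>), against the hypothesis on \<open>p\<close>.
\<close>

section \<open>Chip firing and harmonic functions modulo a prime\<close>

text \<open>
  The weight \<open>w\<close> forces termination: each firing strictly raises the total weight, which a
  fixed number of chips keeps below a bound.
\<close>

lemma firing_stabilises:
  fixes x :: "'v \<Rightarrow> int" and w :: "'v \<Rightarrow> nat" and m :: int
  assumes "finite V"
    and closed: "\<And>b. b \<in> V \<Longrightarrow> \<sigma> b \<in> V \<and> \<tau> b \<in> V"
    and harm: "\<And>b. b \<in> V \<Longrightarrow> [2 * x b = x (\<sigma> b) + x (\<tau> b)] (mod m)"
    and w: "\<And>b. b \<in> V \<Longrightarrow> b \<noteq> r \<Longrightarrow> 2 * w b < w (\<sigma> b) + w (\<tau> b)"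
    and "set_mset M \<subseteq> V"
  shows "\<exists>M'. set_mset M' \<subseteq> V \<and> size M' = size M \<and>
           [(\<Sum>b\<in>#M'. x b) = (\<Sum>b\<in>#M. x b)] (mod m) \<and> (\<forall>b. b \<noteq> r \<longrightarrow> count M' b \<le> 1)"
  using assms(5)
proof (induction "size M * Max (w ` V) - (\<Sum>b\<in>#M. w b)" arbitrary: M rule: less_induct)
  case less
  show ?case
  proof (cases "\<forall>b. b \<noteq> r \<longrightarrow> count M b \<le> 1")
    case True
    then show ?thesis using less.prems by (intro exI[of _ M]) auto
  next
    case False
    then obtain b where b: "b \<noteq> r" "2 \<le> count M b" by force
    then have "{#b, b#} \<subseteq># M" by (auto simp: subseteq_mset_def)
    then obtain N where N: "M = N + {#b, b#}"
      by (metis subset_mset.add_diff_inverse add.commute)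
    let ?M = "N + {#\<sigma> b, \<tau> b#}"
    have bV: "b \<in> V" using less.prems N by auto
    have sub: "set_mset ?M \<subseteq> V" using less.prems N closed[OF bV] by auto
    have bound: "(\<Sum>b\<in>#K. w b) \<le> size K * Max (w ` V)" if "set_mset K \<subseteq> V" for K
      using that
    proof (induction K)
      case (add y K)
      then have "w y \<le> Max (w ` V)" using \<open>finite V\<close> by simp
      then show ?case using add by auto
    qed simp
    have "(\<Sum>b\<in>#M. w b) < (\<Sum>b\<in>#?M. w b)" using w[OF bV b(1)] N by simp
    moreover have "size ?M = size M" using N by simp
    ultimately have "size ?M * Max (w ` V) - (\<Sum>b\<in>#?M. w b) < size M * Max (w ` V) - (\<Sum>b\<in>#M. w b)"
      using bound[OF sub] by simp
    from less.hyps[OF this sub] obtain M' where M': "set_mset M' \<subseteq> V" "size M' = size ?M"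
      "[(\<Sum>b\<in>#M'. x b) = (\<Sum>b\<in>#?M. x b)] (mod m)" "\<forall>b. b \<noteq> r \<longrightarrow> count M' b \<le> 1"
      by blast
    have "[(\<Sum>b\<in>#N. x b) + (x (\<sigma> b) + x (\<tau> b)) = (\<Sum>b\<in>#N. x b) + 2 * x b] (mod m)"
      by (intro cong_add cong_refl cong_sym[OF harm[OF bV]])
    then have "[(\<Sum>b\<in>#?M. x b) = (\<Sum>b\<in>#M. x b)] (mod m)"
      using N by (simp add: add_ac)
    then show ?thesis using M' \<open>size ?M = size M\<close> by (metis cong_trans)
  qed
qed

text \<open>
  In a stable configuration the chips outside \<open>r\<close> form a set, and all others lie at \<open>r\<close>; so
  this set and the number of chips determine the sum.
\<close>

lemma stable_sum:
  fixes x :: "'v \<Rightarrow> int"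
  assumes "\<forall>b. b \<noteq> r \<longrightarrow> count M b \<le> 1"
  shows "(\<Sum>b\<in>#M. x b) = int (size M) * x r + (\<Sum>b\<in>set_mset M - {r}. x b - x r)"
  using assms
proof (induction M)
  case (add y M)
  have le: "\<forall>b. b \<noteq> r \<longrightarrow> count M b \<le> 1"
  proof (intro allI impI)
    fix b assume "b \<noteq> r"
    then have "count (add_mset y M) b \<le> 1" using add.prems by blast
    then show "count M b \<le> 1" by (auto split: if_splits)
  qed
  show ?case
  proof (cases "y = r")
    case True
    then show ?thesis using add.IH[OF le] by (simp add: algebra_simps)
  next
    case False
    then have "count (add_mset y M) y \<le> 1" using add.prems by blast
    then have "y \<notin># M" by (simp add: not_in_iff)
    moreover have "insert y (set_mset M) - {r} = insert y (set_mset M - {r})" using False by auto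
    ultimately show ?thesis using add.IH[OF le] by (simp add: algebra_simps)
  qed
qed simp

text \<open>
  Pigeonhole principle: the \<open>p\<close> configurations with \<open>j\<close> chips at \<open>u\<close> and \<open>p - 1 - j\<close> chips at
  \<open>r\<close> have distinct sums modulo \<open>p\<close>, hence stabilise to distinct subsets of \<open>V - {r}\<close>.
\<close>

lemma harmonic_with_weight_bound:
  fixes x :: "'v \<Rightarrow> int" and w :: "'v \<Rightarrow> nat" and p :: nat
  assumes "prime p" "finite V"
    and closed: "\<And>b. b \<in> V \<Longrightarrow> \<sigma> b \<in> V \<and> \<tau> b \<in> V"
    and harm: "\<And>b. b \<in> V \<Longrightarrow> [2 * x b = x (\<sigma> b) + x (\<tau> b)] (mod int p)"
    and w: "\<And>b. b \<in> V \<Longrightarrow> b \<noteq> r \<Longrightarrow> 2 * w b < w (\<sigma> b) + w (\<tau> b)"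
    and r: "r \<in> V" and u: "u \<in> V" and ne: "\<not> [x u = x r] (mod int p)"
  shows "p \<le> 2 ^ (card V - 1)"
proof -
  define s where "s T = int (p - 1) * x r + (\<Sum>b\<in>T. x b - x r)" for T
  have "\<exists>T\<in>Pow (V - {r}). [s T = int j * (x u - x r) + int (p - 1) * x r] (mod int p)"
    if "j < p" for j
  proof -
    let ?M = "replicate_mset j u + replicate_mset (p - 1 - j) r"
    have "set_mset ?M \<subseteq> V" using r u by (auto simp: in_replicate_mset)
    from firing_stabilises[OF \<open>finite V\<close> closed harm w this] obtain M where
      M: "set_mset M \<subseteq> V" "size M = size ?M" "[(\<Sum>b\<in>#M. x b) = (\<Sum>b\<in>#?M. x b)] (mod int p)"
        "\<forall>b. b \<noteq> r \<longrightarrow> count M b \<le> 1"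
      by blast
    have "size M = p - 1" using M(2) that by simp
    then have "(\<Sum>b\<in>#M. x b) = s (set_mset M - {r})"
      unfolding s_def using stable_sum[OF M(4), of x] by simp
    moreover have "(\<Sum>b\<in>#?M. x b) = int j * (x u - x r) + int (p - 1) * x r"
      using that by (simp add: of_nat_diff algebra_simps)
    ultimately show ?thesis using M(1,3) by (intro bexI[of _ "set_mset M - {r}"]) auto
  qed
  then obtain T where T: "\<And>j. j < p \<Longrightarrow> T j \<in> Pow (V - {r})"
    and s: "\<And>j. j < p \<Longrightarrow> [s (T j) = int j * (x u - x r) + int (p - 1) * x r] (mod int p)"
    by metis
  have "inj_on T {..<p}"
  proof (rule inj_onI)
    fix i j assume ij: "i \<in> {..<p}" "j \<in> {..<p}" "T i = T j"
    then have "[int i * (x u - x r) + int (p - 1) * x r = int j * (x u - x r) + int (p - 1) * x r]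
                 (mod int p)"
      using s[of i] s[of j] by (metis cong_sym cong_trans lessThan_iff)
    then have "[int i * (x u - x r) = int j * (x u - x r)] (mod int p)"
      by (simp add: cong_add_rcancel)
    moreover have "coprime (x u - x r) (int p)"
      using prime_imp_coprime[of "int p" "x u - x r"] ne \<open>prime p\<close>
      by (simp add: cong_iff_dvd_diff coprime_commute)
    ultimately have "[int i = int j] (mod int p)" by (simp add: cong_mult_rcancel)
    then show "i = j" using ij by (simp add: cong_int_iff cong_less_modulus_unique_nat)
  qed
  moreover have "T ` {..<p} \<subseteq> Pow (V - {r})" using T by blast
  ultimately have "card {..<p} \<le> card (Pow (V - {r}))"
    using \<open>finite V\<close> by (meson card_inj_on_le finite_Pow_iff finite_Diff)
  then show ?thesis using \<open>finite V\<close> r by (simp add: card_Pow)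
qed

section \<open>Harmonic functions on graphs of permutations\<close>

text \<open>
  Weights decay by a factor of three with the distance to \<open>r\<close>.  When a vertex fires, the chip
  that moves one step nearer to \<open>r\<close> thus outweighs both of the chips removed, wherever the
  other chip goes.
\<close>

lemma weight_from_reachability:
  assumes "finite V" and reach: "\<And>b. b \<in> V \<Longrightarrow> (b, r) \<in> R\<^sup>*"
  shows "\<exists>w :: 'v \<Rightarrow> nat. \<forall>b\<in>V. b \<noteq> r \<longrightarrow> (\<exists>c. (b, c) \<in> R \<and> 2 * w b < w c)"
proof -
  define d where "d b = (LEAST n. (b, r) \<in> R ^^ n)" for b
  define K where "K = Max (d ` V)"
  show ?thesis
  proof (intro exI[of _ "\<lambda>b. 3 ^ (K - d b)"] ballI impI)
    fix b assume b: "b \<in> V" "b \<noteq> r"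
    have "\<exists>n. (b, r) \<in> R ^^ n" using reach[OF b(1)] by (simp add: rtrancl_power)
    then have db: "(b, r) \<in> R ^^ d b" unfolding d_def by (rule LeastI_ex)
    with b(2) obtain n where n: "d b = Suc n" by (cases "d b") auto
    with db obtain c where c: "(b, c) \<in> R" "(c, r) \<in> R ^^ n" by (metis relpow_Suc_D2)
    have "d c \<le> n" unfolding d_def using c(2) by (rule Least_le)
    moreover have "d b \<le> K" unfolding K_def using b(1) \<open>finite V\<close> by simp
    ultimately have "Suc (K - d b) \<le> K - d c" using n by simp
    then have "(3::nat) ^ Suc (K - d b) \<le> 3 ^ (K - d c)" by (intro power_increasing) auto
    moreover have "(0::nat) < 3 ^ (K - d b)" by simp
    ultimately have "2 * (3::nat) ^ (K - d b) < 3 ^ (K - d c)" unfolding power_Suc by linarith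
    then show "\<exists>c. (b, c) \<in> R \<and> 2 * (3::nat) ^ (K - d b) < 3 ^ (K - d c)" using c(1) by blast
  qed
qed

text \<open>
  On a finite set, \<open>V\<close> and its preimage under a permutation have equal size, so one inclusion
  between them is an equality.  This is what keeps chips among the vertices that reach \<open>r\<close>.
\<close>

lemma permutation_preserves_backward_closed:
  assumes "finite A" "bij_betw \<pi> A A" "V \<subseteq> A" and preds: "\<And>b. b \<in> A \<Longrightarrow> \<pi> b \<in> V \<Longrightarrow> b \<in> V"
  shows "\<pi> ` V \<subseteq> V"
proof -
  have "V \<subseteq> \<pi> ` V" using assms by (force simp: bij_betw_def)
  moreover have "card (\<pi> ` V) = card V"
    using assms by (meson bij_betw_def card_image inj_on_subset)
  ultimately show ?thesis using assms by (metis card_subset_eq finite_imageI finite_subset order_refl)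
qed

text \<open>
  The analogue modulo \<open>p\<close> of the fact that real harmonic functions are constant along edges.
  A failure at the edge from \<open>u\<close> to \<open>\<tau> u\<close> is refuted by taking \<open>\<tau> u\<close> as the sink, which
  places \<open>u\<close> among the vertices that reach it.
\<close>

lemma harmonic_imp_invariant:
  fixes x :: "'v \<Rightarrow> int" and p :: nat
  assumes "prime p" "finite A" and small: "2 ^ (card A - 1) < p"
    and perm: "bij_betw \<sigma> A A" "bij_betw \<tau> A A"
    and harm: "\<And>b. b \<in> A \<Longrightarrow> [2 * x b = x (\<sigma> b) + x (\<tau> b)] (mod int p)"
    and "u \<in> A"
  shows "[x u = x (\<tau> u)] (mod int p)"
proof (rule ccontr)
  assume ne: "\<not> [x u = x (\<tau> u)] (mod int p)"
  define r where "r = \<tau> u"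
  define R where "R = {(b, c). b \<in> A \<and> (c = \<sigma> b \<or> c = \<tau> b)}"
  define V where "V = {b \<in> A. (b, r) \<in> R\<^sup>*}"
  have fin: "finite V" and VA: "V \<subseteq> A" using \<open>finite A\<close> by (auto simp: V_def)
  have preds: "b \<in> V" if "b \<in> A" "\<sigma> b \<in> V \<or> \<tau> b \<in> V" for b
    using that by (auto simp: V_def R_def intro: converse_rtrancl_into_rtrancl)
  have closed: "\<sigma> b \<in> V \<and> \<tau> b \<in> V" if "b \<in> V" for b
    using permutation_preserves_backward_closed[OF \<open>finite A\<close> perm(1) VA]
      permutation_preserves_backward_closed[OF \<open>finite A\<close> perm(2) VA] preds that by blast
  have "r \<in> V" using perm(2) \<open>u \<in> A\<close> by (auto simp: V_def r_def bij_betw_def)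
  then have "u \<in> V" using preds \<open>u \<in> A\<close> r_def by blast
  have "(b, r) \<in> R\<^sup>*" if "b \<in> V" for b using that by (simp add: V_def)
  from weight_from_reachability[OF fin this] obtain w :: "'v \<Rightarrow> nat"
    where w: "\<forall>b\<in>V. b \<noteq> r \<longrightarrow> (\<exists>c. (b, c) \<in> R \<and> 2 * w b < w c)"
    by blast
  have w': "2 * w b < w (\<sigma> b) + w (\<tau> b)" if "b \<in> V" "b \<noteq> r" for b
    using w that by (fastforce simp: R_def)
  have "p \<le> 2 ^ (card V - 1)"
    using harmonic_with_weight_bound[OF \<open>prime p\<close> fin closed _ w' \<open>r \<in> V\<close> \<open>u \<in> V\<close>] harm VA ne
    by (auto simp: r_def)
  also have "\<dots> \<le> 2 ^ (card A - 1)"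
    using card_mono[OF \<open>finite A\<close> VA] by (intro power_increasing) auto
  finally show False using small by simp
qed

section \<open>The identity as an acyclic matching\<close>

lemma identity_matching:
  assumes "comm_group G" "finite A" "A \<subseteq> carrier G"
    and "A \<inter> (\<lambda>a. a [^]\<^bsub>G\<^esub> (2::nat)) ` A = {}"
  shows "matching G A A id"
proof -
  interpret comm_group G by fact
  have sq: "a [^]\<^bsub>G\<^esub> (2::nat) = a \<otimes>\<^bsub>G\<^esub> a" if "a \<in> A" for a
    using that assms(3) by (auto simp: numeral_2_eq_2)
  have "a \<otimes>\<^bsub>G\<^esub> a \<notin> A" if "a \<in> A" for a
    using that assms(4) sq[OF that] by (metis IntI empty_iff imageI)
  moreover from this[of "\<one>\<^bsub>G\<^esub>"] have "\<one>\<^bsub>G\<^esub> \<notin> A" by auto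
  ultimately show ?thesis
    using assms by (auto simp: matching_def matchable_pair_def)
qed

theorem theorem1p2:
  fixes p k :: nat and A :: "int set"
  assumes "prime p"
    and "A \<subseteq> carrier (integer_mod_group p)"
    and "card A = k"
    and "k * 2 ^ (k - 1) < p"
    and "A \<inter> (\<lambda>a. a [^]\<^bsub>integer_mod_group p\<^esub> (2::nat)) ` A = {}"
  shows "acyclic_matching (integer_mod_group p) A A id"
proof -
  let ?G = "integer_mod_group p"
  have p: "p > 0" using \<open>prime p\<close> by (rule prime_gt_0_nat)
  have A: "A \<subseteq> {0..<int p}" using assms(2) p by (simp add: carrier_integer_mod_group)
  then have fin: "finite A" by (rule finite_subset) simp
  have mult: "a \<otimes>\<^bsub>?G\<^esub> b = (a + b) mod int p" for a b using p by simp
  have mod_inj: "a = b" if "a \<in> A" "b \<in> A" "[a = b] (mod int p)" for a b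
    using that A cong_less_imp_eq_int[of a "int p" b] by (meson atLeastLessThan_iff subsetD)
  have "\<forall>a\<in>A. id a = g a"
    if g: "matching ?G A A g"
      and mult_eq: "\<forall>x\<in>carrier ?G. matching_mult ?G A id x = matching_mult ?G A g x" for g
  proof (cases "k \<le> 1")
    \<comment> \<open>The hypothesis \<open>k * 2 ^ (k - 1) < p\<close> confines \<open>p = 2\<close>, where halves are not unique, to this case.\<close>
    case True
    have "g a \<in> A" if "a \<in> A" for a using g that by (auto simp: matching_def bij_betw_def)
    then show ?thesis using True fin \<open>card A = k\<close>
      by (metis One_nat_def card_le_Suc0_iff_eq id_apply)
  next
    case False
    have gA: "bij_betw g A A" using g by (simp add: matching_def)
    have "2 ^ 1 \<le> (2::nat) ^ (k - 1)" using False by (intro power_increasing) auto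
    then have "2 * 2 \<le> k * 2 ^ (k - 1)" using False by (intro mult_mono) auto
    then have "coprime 2 (int p)"
      using assms(4) \<open>prime p\<close> by (simp add: prime_odd_nat)
    have small: "2 ^ (card A - 1) < p"
      using assms(4) False mult_le_mono1[of 1 k "2 ^ (k - 1)"] unfolding assms(3) by linarith
    \<comment> \<open>Doubling is injective as \<open>p\<close> is odd, so the multiplicities of the identity are at most one;
      this makes the halves \<open>h a\<close> of \<open>a + g a\<close> distinct.\<close>
    have half: "b = c" if "b \<in> A" "c \<in> A" "[2 * b = 2 * c] (mod int p)" for b c
      using that mod_inj \<open>coprime 2 (int p)\<close> by (auto simp: cong_mult_lcancel)
    have ex: "\<exists>b\<in>A. [2 * b = a + g a] (mod int p)" if "a \<in> A" for a
    proof -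
      let ?x = "(a + g a) mod int p"
      have "?x \<in> carrier ?G" using p by (simp add: carrier_integer_mod_group)
      moreover have "a \<in> {a \<in> A. a \<otimes>\<^bsub>?G\<^esub> g a = ?x}" using that mult by simp
      ultimately have "card {b \<in> A. b \<otimes>\<^bsub>?G\<^esub> b = ?x} > 0"
        using mult_eq fin by (auto simp: matching_mult_def card_gt_0_iff)
      then show ?thesis using mult by (fastforce simp: card_gt_0_iff cong_def)
    qed
    then obtain h where hA: "\<And>a. a \<in> A \<Longrightarrow> h a \<in> A"
      and h: "\<And>a. a \<in> A \<Longrightarrow> [2 * h a = a + g a] (mod int p)" by metis
    have "inj_on h A"
    proof (rule inj_onI)
      fix a b assume ab: "a \<in> A" "b \<in> A" "h a = h b"
      let ?x = "(a + g a) mod int p"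
      have x: "?x = (b + g b) mod int p" using h[of a] h[of b] ab by (simp add: cong_def)
      have "?x \<in> carrier ?G" using p by (simp add: carrier_integer_mod_group)
      then have "card {a \<in> A. a \<otimes>\<^bsub>?G\<^esub> g a = ?x} = card {c \<in> A. c \<otimes>\<^bsub>?G\<^esub> c = ?x}"
        using mult_eq by (simp add: matching_mult_def)
      also have "\<dots> \<le> Suc 0"
        using fin half by (subst card_le_Suc0_iff_eq) (auto simp: mult cong_def)
      finally have le: "card {a \<in> A. a \<otimes>\<^bsub>?G\<^esub> g a = ?x} \<le> Suc 0" .
      have "a \<in> {a \<in> A. a \<otimes>\<^bsub>?G\<^esub> g a = ?x}" "b \<in> {a \<in> A. a \<otimes>\<^bsub>?G\<^esub> g a = ?x}"
        using ab x mult by simp_all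
      moreover have "finite {a \<in> A. a \<otimes>\<^bsub>?G\<^esub> g a = ?x}" using fin by simp
      ultimately show "a = b" using le card_le_Suc0_iff_eq by blast
    qed
    then have hbij: "bij_betw h A A"
      using fin hA by (simp add: bij_betw_def endo_inj_surj image_subsetI)
    let ?\<tau> = "inv_into A h"
    have \<tau>: "bij_betw ?\<tau> A A" using hbij by (rule bij_betw_inv_into)
    show ?thesis
    proof
      fix a assume a: "a \<in> A"
      have harm: "[2 * b = (g \<circ> ?\<tau>) b + ?\<tau> b] (mod int p)" if "b \<in> A" for b
        using h[of "?\<tau> b"] that hbij \<tau>
        by (auto simp: bij_betw_inv_into_right bij_betwE add.commute)
      have "[h a = ?\<tau> (h a)] (mod int p)"
        by (rule harmonic_imp_invariant[OF \<open>prime p\<close> fin small bij_betw_trans[OF \<tau> gA] \<tau>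
              harm hA[OF a]])
      then have "[h a = a] (mod int p)" using \<open>inj_on h A\<close> a by simp
      then have "h a = a" using mod_inj hA a by blast
      then have "[a + a = a + g a] (mod int p)" using h[OF a] by simp
      then have "[a = g a] (mod int p)" by (simp only: cong_add_lcancel)
      then show "id a = g a" using mod_inj a gA by (auto simp: bij_betw_def)
    qed
  qed
  moreover have "matching ?G A A id"
    using identity_matching[OF abelian_integer_mod_group fin assms(2,5)] .
  ultimately show ?thesis by (auto simp: acyclic_matching_def)
qed

end
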